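(* Let $X$ be a real normed space such that every point of $S_X$ is a denting point of $B_X$. (i) Let $L\subset X$ be a locally compact cone. For every $\varepsilon\in(0,1)$ there exist Bishop--Phelps cones $C_1,\ldots,C_m$ such that $D_L^\varepsilon:=\bigcup_{i=1}^mC_i$ is closed, \[ L\setminus\{0_X\}\subset\operatorname{int}D_L^\varepsilon,\qquad L\subset D_L^\varepsilon\subset L_\varepsilon, \] and \[ d_H(D_L^\varepsilon\cap S_X,B_L)\le2\varepsilon,\qquad d_H(D_L^\varepsilon\cap RB_X,L\cap RB_X)\le2R\varepsilon\quad(R>0). \] Hence $D_L^\varepsilon\cap S_X\to B_L$ and $D_L^\varepsilon\cap RB_X\to L\cap RB_X$ in Hausdorff distance as $\varepsilon\downarrow0$, for every $R>0$. (ii) Let $L,K\subset X$ be cones with $L\cap K=\{0_X\}$, where $L$ is locally compact and $K$ is closed, and put $d:=d(B_L,K)>0$. For every $0<\varepsilon<\min\{1,d\}$, the cones $C_1,\dots,C_m$ in (i) may be chosen so that all conclusions of (i) hold for $\varepsilon$ and, in addition, $D_L^\varepsilon\cap K=\{0_X\}$. Writing $C_i=C(g_i,\alpha_i)$, the function \[ \Phi_{\mathrm{BP},\varepsilon}(x):=\frac12\max_{1\le i\le m}\bigl(g_i(x)-\alpha_i\|x\|\bigr) \] is continuous and positively homogeneous, with $D_L^\varepsilon=\{\Phi_{\mathrm{BP},\varepsilon}\ge0\}$ and $|\Phi_{\mathrm{BP},\varepsilon}(x)|\le\|x\|$ for all $x\in X$. Moreover, for some $\eta_\varepsilon>0$,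 \[ \Phi_{\mathrm{BP},\varepsilon}(l)\ge\eta_\varepsilon\|l\|>0\quad(l\in L\setminus\{0_X\}),\qquad \Phi_{\mathrm{BP},\varepsilon}(k)<0\quad(k\in K\setminus\{0_X\}). \] (iii) Let $L,K\subset X$ be locally compact cones with $L\cap K=\{0_X\}$, and put $d:=d(B_L,B_K)>0$. For every $0<\varepsilon<\min\{1,d/4\}$ there exist finite unions of Bishop--Phelps cones $D_L^\varepsilon,D_K^\varepsilon$ such that \[ L\setminus\{0_X\}\subset\operatorname{int}D_L^\varepsilon,\qquad K\setminus\{0_X\}\subset\operatorname{int}D_K^\varepsilon, \] \[ L\subset D_L^\varepsilon\subset L_\varepsilon,\qquad K\subset D_K^\varepsilon\subset K_\varepsilon,\qquad D_L^\varepsilon\cap D_K^\varepsilon=\{0_X\}, \] and \[ \max\{d_H(D_L^\varepsilon\cap S_X,B_L),\,d_H(D_K^\varepsilon\cap S_X,B_K)\}\le2\varepsilon, \] \[ \max\{d_H(D_L^\varepsilon\cap RB_X,L\cap RB_X),\,d_H(D_K^\varepsilon\cap RB_X,K\cap RB_X)\}\le2R\varepsilon,\qquad R>0. \]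
   Context: $S_X$, $B_X$ are the unit sphere and closed unit ball of $X$, $S_{X^*}$ the unit sphere of the dual, $B(x,r)=x+rB_X$, $\operatorname{cone}(A)=\{ta:t\ge0,\ a\in A\}$, $d(x,A)=\inf_{a\in A}\|x-a\|$, $d(A,B)=\inf_{a\in A}d(a,B)$, and for nonempty closed bounded sets $d_H(A,B)=\max\{\sup_{a\in A}d(a,B),\sup_{b\in B}d(b,A)\}$. A nonempty set $C\subset X$ is a cone if $tC\subset C$ for every $t\ge 0$; all cones are assumed proper, i.e. $\{0_X\}\subsetneq C\subsetneq X$ (not necessarily convex). A Bishop--Phelps cone is a set $C(g,\alpha):=\{x\in X:g(x)\ge\alpha\|x\|\}$ with $g\in S_{X^*}$, $0<\alpha<1$. A point $u\in B_X$ is a denting point of $B_X$ if for every $\varepsilon>0$ there exist $f\in S_{X^*}$ and $\gamma>0$ such that the slice $\{x\in B_X:f(x)>1-\gamma\}$ contains $u$ and has diameter $<\varepsilon$. A cone $L$ is locally compact if for every $x\in L$ there is $r>0$ with $L\cap B(x,r)$ norm compact. For a cone $L$, $B_L:=L\cap S_X$ and $L_\varepsilon:=\operatorname{cone}(B_L+\varepsilon B_X)$. A mapping is positively homogeneous if $\Phi(tx)=t\Phi(x)$ for all $t\ge0$, $x\in X$. *)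

theory Defs
  imports "HOL-Analysis.Analysis"
begin

text \<open>
  The dual of a real normed space \<open>'a\<close> is the type of bounded linear functions
  \<open>'a \<Rightarrow>\<^sub>L real\<close> with the operator norm; \<open>S\<^sub>X\<close>, \<open>B\<^sub>X\<close>, \<open>R B\<^sub>X\<close> and \<open>B(x,r)\<close> are
  \<open>sphere 0 1\<close>, \<open>cball 0 1\<close>, \<open>cball 0 R\<close> and \<open>cball x r\<close>; \<open>d(x,A)\<close> is \<open>infdist x A\<close>
  and \<open>d(A,B)\<close> is \<open>setdist A B\<close>.
\<close>

text \<open>Meaningful for nonempty bounded sets only, since \<open>Sup\<close> on the reals is unspecified otherwise.\<close>

definition hausdorff_distance :: "'a::metric_space set \<Rightarrow> 'a set \<Rightarrow> real" where
  "hausdorff_distance A B = max (SUP a\<in>A. infdist a B) (SUP b\<in>B. infdist b A)"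

definition generated_cone :: "'a::real_vector set \<Rightarrow> 'a set" where
  "generated_cone A = {t *\<^sub>R a | t a. 0 \<le> t \<and> a \<in> A}"

definition proper_cone :: "'a::real_vector set \<Rightarrow> bool" where
  "proper_cone C \<longleftrightarrow> cone C \<and> {0} \<subset> C \<and> C \<subset> UNIV"

definition locally_compact_cone :: "'a::real_normed_vector set \<Rightarrow> bool" where
  "locally_compact_cone L \<longleftrightarrow>
     proper_cone L \<and> (\<forall>x\<in>L. \<exists>r>0. compact (L \<inter> cball x r))"

definition bp_cone :: "('a::real_normed_vector \<Rightarrow>\<^sub>L real) \<Rightarrow> real \<Rightarrow> 'a set" where
  "bp_cone g \<alpha> = {x. blinfun_apply g x \<ge> \<alpha> * norm x}"

definition bishop_phelps_cone :: "'a::real_normed_vector set \<Rightarrow> bool" where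
  "bishop_phelps_cone C \<longleftrightarrow>
     (\<exists>g \<alpha>. norm g = 1 \<and> 0 < \<alpha> \<and> \<alpha> < 1 \<and> C = bp_cone g \<alpha>)"

definition ball_slice :: "('a::real_normed_vector \<Rightarrow>\<^sub>L real) \<Rightarrow> real \<Rightarrow> 'a set" where
  "ball_slice f \<gamma> = {x \<in> cball 0 1. blinfun_apply f x > 1 - \<gamma>}"

definition denting_point_of_ball :: "'a::real_normed_vector \<Rightarrow> bool" where
  "denting_point_of_ball u \<longleftrightarrow>
     u \<in> cball 0 1 \<and>
     (\<forall>\<epsilon>>0. \<exists>f \<gamma>. norm f = 1 \<and> \<gamma> > 0 \<and> u \<in> ball_slice f \<gamma> \<and> diameter (ball_slice f \<gamma>) < \<epsilon>)"

text \<open>The sets \<open>B\<^sub>L\<close> and \<open>L\<^sub>\<epsilon>\<close>.\<close>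

definition cone_base :: "'a::real_normed_vector set \<Rightarrow> 'a set" where
  "cone_base L = L \<inter> sphere 0 1"

definition cone_enlargement :: "'a::real_normed_vector set \<Rightarrow> real \<Rightarrow> 'a set" where
  "cone_enlargement L \<epsilon> =
     generated_cone {b + \<epsilon> *\<^sub>R u | b u. b \<in> cone_base L \<and> u \<in> cball 0 1}"

definition positively_homogeneous :: "('a::real_vector \<Rightarrow> 'b::real_vector) \<Rightarrow> bool" where
  "positively_homogeneous \<Phi> \<longleftrightarrow> (\<forall>t\<ge>0. \<forall>x. \<Phi> (t *\<^sub>R x) = t *\<^sub>R \<Phi> x)"

definition bp_cones :: "nat \<Rightarrow> (nat \<Rightarrow> 'a::real_normed_vector set) \<Rightarrow> bool" where
  "bp_cones m C \<longleftrightarrow> m \<ge> 1 \<and> (\<forall>i\<in>{1..m}. bishop_phelps_cone (C i))"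

definition finite_bp_union :: "'a::real_normed_vector set \<Rightarrow> bool" where
  "finite_bp_union D \<longleftrightarrow> (\<exists>m C. bp_cones m C \<and> D = (\<Union>i\<in>{1..m}. C i))"

definition outer_approximation :: "'a::real_normed_vector set \<Rightarrow> real \<Rightarrow> 'a set \<Rightarrow> bool" where
  "outer_approximation L \<epsilon> D \<longleftrightarrow>
     closed D \<and>
     L - {0} \<subseteq> interior D \<and>
     L \<subseteq> D \<and> D \<subseteq> cone_enlargement L \<epsilon> \<and>
     hausdorff_distance (D \<inter> sphere 0 1) (cone_base L) \<le> 2 * \<epsilon> \<and>
     (\<forall>R>0. hausdorff_distance (D \<inter> cball 0 R) (L \<inter> cball 0 R) \<le> 2 * R * \<epsilon>)"

definition Phi_BP ::
    "nat \<Rightarrow> (nat \<Rightarrow> 'a::real_normed_vector \<Rightarrow>\<^sub>L real) \<Rightarrow> (nat \<Rightarrow> real) \<Rightarrow> 'a \<Rightarrow> real" where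
  "Phi_BP m g \<alpha> x = 1 / 2 * Max ((\<lambda>i. blinfun_apply (g i) x - \<alpha> i * norm x) ` {1..m})"

end

theory Submission
  imports Defs
begin

text \<open>
  At a denting point \<open>u\<close> of the unit ball, a small slice \<open>{f > 1 - \<gamma>}\<close> around \<open>u\<close> yields the
  Bishop--Phelps cone \<open>{f \<ge> \<alpha> \<parallel>\<cdot>\<parallel>}\<close> with \<open>1 - \<gamma> < \<alpha> < f u\<close>: it contains \<open>u\<close> in its interior, and
  its unit vectors lie in the slice, hence are close to \<open>u\<close>. The base of a locally compact cone
  \<open>L\<close> is compact, so finitely many of these cones cover \<open>L - {0}\<close> by their interiors. All distance
  estimates and the separation from \<open>K\<close> follow since each unit vector of the union is within
  \<open>\<epsilon>\<close> of the base of \<open>L\<close>.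
\<close>

section \<open>Bishop-Phelps cones, their interiors, and slices at denting points\<close>

lemma closed_bp_cone: "closed (bp_cone g \<alpha>)"
  unfolding bp_cone_def by (intro closed_Collect_le continuous_intros)

lemma zero_in_bp_cone: "0 \<in> bp_cone g \<alpha>"
  by (simp add: bp_cone_def)

lemma scaleR_in_bp_cone:
  assumes "x \<in> bp_cone g \<alpha>" "0 \<le> t"
  shows "t *\<^sub>R x \<in> bp_cone g \<alpha>"
  using mult_left_mono[of "\<alpha> * norm x" "blinfun_apply g x" t] assms
  by (simp add: bp_cone_def blinfun.scaleR_right mult.left_commute)

text \<open>The strict set is open, being defined by continuous functions. Conversely,
  \<open>norm g = 1 > \<alpha>\<close> forces some \<open>v\<close> with
  \<open>g v > \<alpha> * norm v\<close>. A small move from an interior point \<open>x\<close>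
  against \<open>v\<close> stays in the cone while \<open>g\<close> loses more than
  \<open>\<alpha> * norm\<close> can lose, so the inequality at \<open>x\<close> has to be
  strict.\<close>

lemma interior_bp_cone:
  assumes "norm g = 1" "0 < \<alpha>" "\<alpha> < 1"
  shows "interior (bp_cone g \<alpha>) = {x. blinfun_apply g x > \<alpha> * norm x}"
proof
  have "open {x. blinfun_apply g x > \<alpha> * norm x}"
    by (intro open_Collect_less continuous_intros)
  moreover have "{x. blinfun_apply g x > \<alpha> * norm x} \<subseteq> bp_cone g \<alpha>"
    by (auto simp: bp_cone_def)
  ultimately show "{x. blinfun_apply g x > \<alpha> * norm x} \<subseteq> interior (bp_cone g \<alpha>)"
    by (simp add: interior_maximal)
next
  obtain w where w: "\<bar>blinfun_apply g w\<bar> > \<alpha> * norm w"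
  proof (rule ccontr)
    assume "\<not> thesis"
    then have "norm (blinfun_apply g w) \<le> \<alpha> * norm w" for w
      using that by (metis not_le real_norm_def)
    then have "norm g \<le> \<alpha>"
      using assms by (intro norm_blinfun_bound) auto
    then show False using assms by simp
  qed
  define v where "v = (if blinfun_apply g w \<ge> 0 then w else - w)"
  have v: "blinfun_apply g v > \<alpha> * norm v"
    using w by (auto simp: v_def blinfun.minus_right)
  show "interior (bp_cone g \<alpha>) \<subseteq> {x. blinfun_apply g x > \<alpha> * norm x}"
  proof
    fix x assume "x \<in> interior (bp_cone g \<alpha>)"
    then obtain e where e: "e > 0" "ball x e \<subseteq> bp_cone g \<alpha>"
      by (auto simp: mem_interior)
    \<comment> \<open>The move \<open>t *\<^sub>R v\<close> has length below \<open>e\<close>;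
      adding 1 keeps the denominator positive without a separate argument that \<open>v\<close> is
      nonzero.\<close>
    define t where "t = e / (2 * (norm v + 1))"
    have t: "t > 0" using e by (simp add: t_def add_nonneg_pos)
    have "t * norm v < e"
    proof -
      have "t * norm v \<le> t * (norm v + 1)" using t by simp
      also have "\<dots> = e / 2"
        using add_nonneg_pos[OF norm_ge_zero[of v] zero_less_one]
        by (simp add: t_def del: distrib_left_numeral)
      also have "\<dots> < e" using e by simp
      finally show ?thesis .
    qed
    then have "x - t *\<^sub>R v \<in> ball x e"
      using t by (simp add: dist_norm)
    then have "blinfun_apply g (x - t *\<^sub>R v) \<ge> \<alpha> * norm (x - t *\<^sub>R v)"
      using e(2) unfolding bp_cone_def by blast
    moreover have "\<alpha> * norm (x - t *\<^sub>R v) \<ge> \<alpha> * (norm x - t * norm v)"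
      using norm_triangle_ineq2[of x "t *\<^sub>R v"] t assms by (intro mult_left_mono) auto
    moreover have "t * blinfun_apply g v > t * (\<alpha> * norm v)"
      using v t by simp
    ultimately show "x \<in> {x. blinfun_apply g x > \<alpha> * norm x}"
      by (simp add: blinfun.diff_right blinfun.scaleR_right algebra_simps)
  qed
qed

lemma denting_point_bp_cone:
  assumes "denting_point_of_ball u" "norm u = 1" "0 < \<epsilon>" "\<epsilon> < 1"
  shows "\<exists>g \<alpha>. norm g = 1 \<and> 0 < \<alpha> \<and> \<alpha> < 1 \<and> u \<in> interior (bp_cone g \<alpha>) \<and>
           (\<forall>x \<in> bp_cone g \<alpha>. norm x = 1 \<longrightarrow> dist x u < \<epsilon>)"
proof -
  obtain f \<gamma> where f: "norm f = 1" "\<gamma> > 0" "u \<in> ball_slice f \<gamma>" "diameter (ball_slice f \<gamma>) < \<epsilon>"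
    using assms by (auto simp: denting_point_of_ball_def)
  have "bounded (ball_slice f \<gamma>)"
    by (rule bounded_subset[OF bounded_cball[of 0 1]]) (auto simp: ball_slice_def)
  then have near: "dist x u < \<epsilon>" if "x \<in> ball_slice f \<gamma>" for x
    using diameter_bounded_bound[of "ball_slice f \<gamma>" x u] that f by simp
  \<comment> \<open>Otherwise the slice would contain 0, at distance 1 from \<open>u\<close>,
    although its diameter is below \<open>\<epsilon> < 1\<close>. This is what makes
    \<open>\<alpha>\<close> positive below.\<close>
  have "0 \<le> 1 - \<gamma>"
  proof (rule ccontr)
    assume "\<not> 0 \<le> 1 - \<gamma>"
    then have "0 \<in> ball_slice f \<gamma>" by (simp add: ball_slice_def)
    from near[OF this] assms show False by simp
  qed
  \<comment> \<open>The midpoint is strict on both sides: \<open>\<alpha> < f u\<close> puts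
    \<open>u\<close> in the interior, and \<open>\<alpha> > 1 - \<gamma>\<close> puts the unit
    vectors of the cone into the slice.\<close>
  define \<alpha> where "\<alpha> = (blinfun_apply f u + (1 - \<gamma>)) / 2"
  have fu: "blinfun_apply f u > 1 - \<gamma>" using f by (simp add: ball_slice_def)
  have "blinfun_apply f u \<le> 1"
    using norm_blinfun[of f u] f assms by simp
  then have \<alpha>: "0 < \<alpha>" "\<alpha> < 1" "\<alpha> > 1 - \<gamma>" "\<alpha> < blinfun_apply f u"
    using fu \<open>0 \<le> 1 - \<gamma>\<close> by (auto simp: \<alpha>_def)
  have "dist x u < \<epsilon>" if "x \<in> bp_cone f \<alpha>" "norm x = 1" for x
    using that \<alpha> by (intro near) (auto simp: ball_slice_def bp_cone_def)
  then show ?thesis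
    using f \<alpha> assms by (intro exI[of _ f] exI[of _ \<alpha>]) (simp add: interior_bp_cone)
qed

section \<open>Proper cones and compactness of the base of a locally compact cone\<close>

lemma scaleR_in_cone: "proper_cone L \<Longrightarrow> x \<in> L \<Longrightarrow> 0 \<le> t \<Longrightarrow> t *\<^sub>R x \<in> L"
  by (auto simp: proper_cone_def cone_def)

lemma normalize_in_cone_base:
  assumes "proper_cone L" "x \<in> L" "x \<noteq> 0"
  shows "(1 / norm x) *\<^sub>R x \<in> cone_base L"
  using scaleR_in_cone[OF assms(1,2), of "1 / norm x"] assms(3) by (simp add: cone_base_def)

lemma cone_base_nonempty:
  assumes "proper_cone L"
  shows "cone_base L \<noteq> {}"
  using assms normalize_in_cone_base by (fastforce simp: proper_cone_def)

text \<open>A compact piece of the cone around the apex is dilated until it reaches radius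
  \<open>R\<close>, which is possible because cones are invariant under positive scaling.\<close>

lemma compact_cone_Int_cball:
  assumes "locally_compact_cone L"
  shows "compact (L \<inter> cball 0 R)"
proof -
  have L: "proper_cone L" using assms by (simp add: locally_compact_cone_def)
  then have "0 \<in> L" by (auto simp: proper_cone_def)
  then obtain r where r: "r > 0" "compact (L \<inter> cball 0 r)"
    using assms by (auto simp: locally_compact_cone_def)
  \<comment> \<open>Using \<open>\<bar>R\<bar> + 1\<close> gives \<open>s > 0\<close> and
    \<open>s * R \<le> r\<close> whatever the sign of \<open>R\<close>.\<close>
  define s where "s = r / (\<bar>R\<bar> + 1)"
  have s: "s > 0" using r by (simp add: s_def)
  have sR: "s * R \<le> r"
  proof -
    have "s * R \<le> s * (\<bar>R\<bar> + 1)" using s by (intro mult_left_mono) auto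
    then show ?thesis by (simp add: s_def)
  qed
  \<comment> \<open>The dilated piece may overshoot radius \<open>R\<close>; cutting with a closed
    ball preserves compactness.\<close>
  have "L \<inter> cball 0 R = (\<lambda>x. (1/s) *\<^sub>R x) ` (L \<inter> cball 0 r) \<inter> cball 0 R"
  proof (intro equalityI subsetI)
    fix x assume x: "x \<in> L \<inter> cball 0 R"
    then have "s * norm x \<le> s * R" using s by simp
    then have "s * norm x \<le> r" using sR by linarith
    then have "s *\<^sub>R x \<in> L \<inter> cball 0 r"
      using x s scaleR_in_cone[OF L, of x s] by simp
    moreover have "x = (1/s) *\<^sub>R (s *\<^sub>R x)" using s by simp
    ultimately show "x \<in> (\<lambda>x. (1/s) *\<^sub>R x) ` (L \<inter> cball 0 r) \<inter> cball 0 R"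
      using x by blast
  next
    fix x assume "x \<in> (\<lambda>x. (1/s) *\<^sub>R x) ` (L \<inter> cball 0 r) \<inter> cball 0 R"
    then show "x \<in> L \<inter> cball 0 R" using s scaleR_in_cone[OF L, of _ "1/s"] by auto
  qed
  moreover have "compact ((\<lambda>x. (1/s) *\<^sub>R x) ` (L \<inter> cball 0 r) \<inter> cball 0 R)"
    by (intro compact_Int_closed compact_scaling r closed_cball)
  ultimately show ?thesis by simp
qed

lemma closed_unit_sphere: "closed (sphere (0::'a::real_normed_vector) 1)"
proof -
  have "closed {x::'a. norm x = 1}" by (intro closed_Collect_eq continuous_intros)
  also have "{x::'a. norm x = 1} = sphere 0 1" by auto
  finally show ?thesis .
qed

lemma compact_cone_base:
  assumes "locally_compact_cone L"
  shows "compact (cone_base L)"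
proof -
  have "cone_base L = (L \<inter> cball 0 1) \<inter> sphere 0 1" by (auto simp: cone_base_def)
  then show ?thesis
    using compact_Int_closed[OF compact_cone_Int_cball[OF assms] closed_unit_sphere] by metis
qed

section \<open>Finite covers by Bishop-Phelps cones and elementary facts on their unions\<close>

text \<open>The cover is by the interiors of the individual cones, which is stronger than lying in
  the interior of the union: it later gives a strict inequality for a single functional, hence
  positivity of \<open>Phi_BP\<close>. Closeness is recorded on unit vectors only, since homogeneity
  extends it.\<close>

lemma finite_bp_cover:
  fixes L :: "'a::real_normed_vector set"
  assumes "\<forall>u \<in> sphere (0 :: 'a) 1. denting_point_of_ball u"
    and L: "locally_compact_cone L" and "0 < \<epsilon>" "\<epsilon> < 1"
  obtains m C where "bp_cones m C" "L - {0} \<subseteq> (\<Union>i\<in>{1..m}. interior (C i))"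
    "\<And>x. x \<in> (\<Union>i\<in>{1..m}. C i) \<Longrightarrow> norm x = 1 \<Longrightarrow> \<exists>u \<in> cone_base L. dist x u < \<epsilon>"
proof -
  have pL: "proper_cone L" using L by (simp add: locally_compact_cone_def)
  have "\<forall>u\<in>cone_base L. \<exists>g \<alpha>. norm g = 1 \<and> 0 < \<alpha> \<and> \<alpha> < 1 \<and> u \<in> interior (bp_cone g \<alpha>) \<and>
           (\<forall>x \<in> bp_cone g \<alpha>. norm x = 1 \<longrightarrow> dist x u < \<epsilon>)"
    using assms by (intro ballI denting_point_bp_cone) (auto simp: cone_base_def)
  then obtain g \<alpha> where g: "\<And>u. u \<in> cone_base L \<Longrightarrow> norm (g u) = 1 \<and> 0 < \<alpha> u \<and> \<alpha> u < 1 \<and>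
      u \<in> interior (bp_cone (g u) (\<alpha> u)) \<and>
      (\<forall>x \<in> bp_cone (g u) (\<alpha> u). norm x = 1 \<longrightarrow> dist x u < \<epsilon>)"
    by metis
  obtain F where F: "F \<subseteq> cone_base L" "finite F"
      "cone_base L \<subseteq> (\<Union>u\<in>F. interior (bp_cone (g u) (\<alpha> u)))"
    using compactE_image[OF compact_cone_base[OF L],
        of "cone_base L" "\<lambda>u. interior (bp_cone (g u) (\<alpha> u))"] g by blast
  \<comment> \<open>The finite set of base points is enumerated from 1, as the indexing in
    \<open>bp_cones\<close> requires.\<close>
  obtain h where h: "bij_betw h {1..card F} F"
    using ex_bij_betw_nat_finite_1[OF F(2)] by blast
  then have hF: "h ` {1..card F} = F" by (simp add: bij_betw_def)
  define C where "C i = bp_cone (g (h i)) (\<alpha> (h i))" for i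
  have hi: "h i \<in> cone_base L" if "i \<in> {1..card F}" for i
    using that hF F(1) by blast
  \<comment> \<open>A proper cone has a nonempty base, so the cover uses at least one cone; this is
    the condition \<open>m \<ge> 1\<close> in \<open>bp_cones\<close>.\<close>
  have "F \<noteq> {}" using F(3) cone_base_nonempty[OF pL] by auto
  then have "bp_cones (card F) C"
    using F(2) g[OF hi] unfolding bp_cones_def bishop_phelps_cone_def C_def
    by (metis One_nat_def Suc_le_eq card_gt_0_iff)
  moreover have "L - {0} \<subseteq> (\<Union>i\<in>{1..card F}. interior (C i))"
  proof
    fix x assume x: "x \<in> L - {0}"
    then have "(1 / norm x) *\<^sub>R x \<in> cone_base L"
      using normalize_in_cone_base[OF pL] by simp
    then obtain u where u: "u \<in> F" "(1 / norm x) *\<^sub>R x \<in> interior (bp_cone (g u) (\<alpha> u))"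
      using F(3) by blast
    then have gu: "norm (g u) = 1" "0 < \<alpha> u" "\<alpha> u < 1" using g F(1) by auto
    \<comment> \<open>The strict inequality describing the interior is invariant under positive
      scaling, so it passes from the normalized vector back to \<open>x\<close>.\<close>
    have "x \<in> interior (bp_cone (g u) (\<alpha> u))"
      using u(2) x by (simp add: interior_bp_cone[OF gu] blinfun.scaleR_right field_simps)
    moreover obtain i where "i \<in> {1..card F}" "u = h i" using u(1) hF by blast
    ultimately show "x \<in> (\<Union>i\<in>{1..card F}. interior (C i))"
      by (intro UN_I[of i]) (auto simp: C_def)
  qed
  moreover have "\<exists>u \<in> cone_base L. dist x u < \<epsilon>"
    if x: "x \<in> (\<Union>i\<in>{1..card F}. C i)" "norm x = 1" for x
  proof -
    obtain i where i: "i \<in> {1..card F}" "x \<in> bp_cone (g (h i)) (\<alpha> (h i))"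
      using x(1) by (auto simp: C_def)
    then have "dist x (h i) < \<epsilon>" using g[OF hi[OF i(1)]] x(2) by blast
    then show ?thesis using hi[OF i(1)] by blast
  qed
  ultimately show thesis by (rule that)
qed

lemma bp_conesE:
  assumes "bp_cones m C" "i \<in> {1..m}"
  obtains g \<alpha> where "norm g = 1" "0 < \<alpha>" "\<alpha> < 1" "C i = bp_cone g \<alpha>"
  using assms unfolding bp_cones_def bishop_phelps_cone_def by blast

lemma bp_union_scaleR:
  assumes "bp_cones m C" "x \<in> (\<Union>i\<in>{1..m}. C i)" "0 \<le> t"
  shows "t *\<^sub>R x \<in> (\<Union>i\<in>{1..m}. C i)"
proof -
  obtain i where i: "i \<in> {1..m}" "x \<in> C i" using assms(2) by blast
  then obtain g \<alpha> where "C i = bp_cone g \<alpha>"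
    using bp_conesE[OF assms(1)] by metis
  then have "t *\<^sub>R x \<in> C i"
    using i(2) assms(3) scaleR_in_bp_cone by blast
  then show ?thesis using i(1) by blast
qed

lemma zero_in_bp_union:
  assumes "bp_cones m C"
  shows "0 \<in> (\<Union>i\<in>{1..m}. C i)"
proof -
  have "1 \<in> {1..m}" using assms by (simp add: bp_cones_def)
  moreover from this have "0 \<in> C 1"
    using bp_conesE[OF assms] zero_in_bp_cone by metis
  ultimately show ?thesis by blast
qed

lemma closed_bp_union:
  assumes "bp_cones m C"
  shows "closed (\<Union>i\<in>{1..m}. C i)"
proof (rule closed_UN)
  show "\<forall>i\<in>{1..m}. closed (C i)" using bp_conesE[OF assms] closed_bp_cone by metis
qed simp

section \<open>Hausdorff estimates and convergence of outer approximations\<close>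

text \<open>For nested sets the distances from points of \<open>B\<close> to \<open>A\<close> all
  vanish, so only the excess of \<open>A\<close> over \<open>B\<close> counts. Any point of
  \<open>B\<close> also lies in \<open>A\<close>, which yields \<open>0 \<le> c\<close>.\<close>

lemma hausdorff_distance_superset_le:
  assumes "B \<noteq> {}" "B \<subseteq> A" "\<And>a. a \<in> A \<Longrightarrow> infdist a B \<le> c"
  shows "hausdorff_distance A B \<le> c"
proof -
  have "A \<noteq> {}" using assms by auto
  then have "(SUP a\<in>A. infdist a B) \<le> c"
    using assms by (intro cSUP_least) auto
  moreover have "(SUP b\<in>B. infdist b A) \<le> c"
  proof (rule cSUP_least[OF assms(1)])
    fix b assume "b \<in> B"
    then have "0 \<le> c" using assms(3)[of b] assms(2) infdist_nonneg[of b B] by force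
    then show "infdist b A \<le> c" using \<open>b \<in> B\<close> assms(2) by (simp add: subsetD)
  qed
  ultimately show ?thesis by (simp add: hausdorff_distance_def)
qed

text \<open>The supremum over \<open>B\<close> is a supremum of zeros, and the maximum dominates it.
  This is the lower bound for the squeeze argument below.\<close>

lemma hausdorff_distance_superset_nonneg:
  assumes "B \<noteq> {}" "B \<subseteq> A"
  shows "0 \<le> hausdorff_distance A B"
proof -
  have "(SUP b\<in>B. infdist b A) = (SUP b\<in>B. 0)"
    using assms by (intro SUP_cong) auto
  then show ?thesis using assms by (simp add: hausdorff_distance_def)
qed

text \<open>All estimates come from one scaled bound, \<open>approx\<close>: each \<open>x\<close>
  in the union lies within \<open>norm x * \<epsilon>\<close> of \<open>norm x *\<^sub>R u\<close>
  for some \<open>u\<close> in the base. It follows from \<open>near\<close> applied to the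
  normalized vector.\<close>

lemma outer_approximationI:
  assumes pL: "proper_cone L" and "0 < \<epsilon>" and C: "bp_cones m C"
    and int: "L - {0} \<subseteq> (\<Union>i\<in>{1..m}. interior (C i))"
    and near: "\<And>x. x \<in> (\<Union>i\<in>{1..m}. C i) \<Longrightarrow> norm x = 1 \<Longrightarrow> \<exists>u \<in> cone_base L. dist x u < \<epsilon>"
  shows "outer_approximation L \<epsilon> (\<Union>i\<in>{1..m}. C i)"
proof -
  define D where "D = (\<Union>i\<in>{1..m}. C i)"
  have intD: "L - {0} \<subseteq> interior D"
  proof -
    have "interior (C i) \<subseteq> interior D" if "i \<in> {1..m}" for i
      using that by (intro interior_mono) (auto simp: D_def)
    then show ?thesis using int by blast
  qed
  have LD: "L \<subseteq> D"
    using intD interior_subset[of D] zero_in_bp_union[OF C] by (auto simp: D_def)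
  have zL: "0 \<in> L" using pL by (auto simp: proper_cone_def)
  have approx: "\<exists>u \<in> cone_base L. norm (x - norm x *\<^sub>R u) \<le> norm x * \<epsilon>"
    if "x \<in> D" for x
  proof (cases "x = 0")
    case True
    then show ?thesis using cone_base_nonempty[OF pL] by auto
  next
    case False
    let ?y = "(1 / norm x) *\<^sub>R x"
    have "?y \<in> D" using bp_union_scaleR[OF C, of x "1 / norm x"] that by (simp add: D_def)
    moreover have "norm ?y = 1" using False by simp
    ultimately obtain u where u: "u \<in> cone_base L" "dist ?y u < \<epsilon>"
      using near unfolding D_def by blast
    have "x - norm x *\<^sub>R u = norm x *\<^sub>R (?y - u)" using False by (simp add: scaleR_diff_right)
    then have "norm (x - norm x *\<^sub>R u) = norm x * dist ?y u"
      by (simp only: norm_scaleR dist_norm) simp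
    then have "norm (x - norm x *\<^sub>R u) \<le> norm x * \<epsilon>" using u(2) by (simp add: mult_left_mono)
    with u(1) show ?thesis by blast
  qed
  have "D \<subseteq> cone_enlargement L \<epsilon>"
  proof
    fix x assume "x \<in> D"
    then obtain u where u: "u \<in> cone_base L" "norm (x - norm x *\<^sub>R u) \<le> norm x * \<epsilon>"
      using approx by blast
    \<comment> \<open>Solves \<open>x = norm x *\<^sub>R (u + \<epsilon> *\<^sub>R v)\<close> for
      \<open>v\<close>. For \<open>x = 0\<close> division by zero gives \<open>v = 0\<close>, and
      both claims below are trivial.\<close>
    define v where "v = (1 / (norm x * \<epsilon>)) *\<^sub>R (x - norm x *\<^sub>R u)"
    have "norm v \<le> 1"
      using u(2) \<open>0 < \<epsilon>\<close> by (cases "x = 0") (auto simp: v_def divide_le_eq simp del: scaleR_diff_right)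
    moreover have "x = norm x *\<^sub>R (u + \<epsilon> *\<^sub>R v)"
      using \<open>0 < \<epsilon>\<close> by (cases "x = 0") (auto simp: v_def scaleR_add_right)
    ultimately show "x \<in> cone_enlargement L \<epsilon>"
      using u(1) unfolding cone_enlargement_def generated_cone_def mem_Collect_eq
      by (intro exI[of _ "norm x"] exI[of _ "u + \<epsilon> *\<^sub>R v"]) auto
  qed
  moreover have "hausdorff_distance (D \<inter> sphere 0 1) (cone_base L) \<le> 2 * \<epsilon>"
  proof (rule hausdorff_distance_superset_le[OF cone_base_nonempty[OF pL]])
    show "cone_base L \<subseteq> D \<inter> sphere 0 1" using LD by (auto simp: cone_base_def)
    fix x assume "x \<in> D \<inter> sphere 0 1"
    then obtain u where "u \<in> cone_base L" "dist x u \<le> \<epsilon>"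
      using approx[of x] by (auto simp: dist_norm)
    then have "infdist x (cone_base L) \<le> \<epsilon>" by (rule infdist_le2)
    then show "infdist x (cone_base L) \<le> 2 * \<epsilon>" using \<open>0 < \<epsilon>\<close> by simp
  qed
  moreover have "hausdorff_distance (D \<inter> cball 0 R) (L \<inter> cball 0 R) \<le> 2 * R * \<epsilon>" if "R > 0" for R
  proof (rule hausdorff_distance_superset_le)
    show "L \<inter> cball 0 R \<noteq> {}" using zL that by force
    show "L \<inter> cball 0 R \<subseteq> D \<inter> cball 0 R" using LD by auto
    fix x assume x: "x \<in> D \<inter> cball 0 R"
    then obtain u where u: "u \<in> cone_base L" "dist x (norm x *\<^sub>R u) \<le> norm x * \<epsilon>"
      using approx[of x] by (auto simp: dist_norm)
    \<comment> \<open>As \<open>u\<close> is a unit vector, the approximating point has the same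
      norm as \<open>x\<close>, so truncation at radius \<open>R\<close> does not remove it.\<close>
    have "norm x *\<^sub>R u \<in> L \<inter> cball 0 R"
      using u(1) x scaleR_in_cone[OF pL, of u "norm x"] by (auto simp: cone_base_def)
    then have "infdist x (L \<inter> cball 0 R) \<le> norm x * \<epsilon>" using u(2) by (rule infdist_le2)
    also have "\<dots> \<le> R * \<epsilon>" using x \<open>0 < \<epsilon>\<close> by simp
    also have "\<dots> \<le> 2 * R * \<epsilon>" using that \<open>0 < \<epsilon>\<close> by simp
    finally show "infdist x (L \<inter> cball 0 R) \<le> 2 * R * \<epsilon>" .
  qed
  moreover have "closed D" using closed_bp_union[OF C] by (simp add: D_def)
  ultimately show ?thesis
    using intD LD unfolding outer_approximation_def D_def by blast
qed

text \<open>A squeeze between 0 and a bound linear in \<open>\<epsilon>\<close>. It covers every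
  family of outer approximations, so convergence is independent of how the cones were
  chosen.\<close>

lemma outer_approximation_tendsto:
  assumes pL: "proper_cone L"
    and D: "\<And>\<epsilon>. 0 < \<epsilon> \<Longrightarrow> \<epsilon> < 1 \<Longrightarrow> outer_approximation L \<epsilon> (D \<epsilon>)"
  shows "((\<lambda>\<epsilon>. hausdorff_distance (D \<epsilon> \<inter> sphere 0 1) (cone_base L)) \<longlongrightarrow> 0) (at_right 0)"
    and "R > 0 \<Longrightarrow>
      ((\<lambda>\<epsilon>. hausdorff_distance (D \<epsilon> \<inter> cball 0 R) (L \<inter> cball 0 R)) \<longlongrightarrow> 0) (at_right 0)"
proof -
  \<comment> \<open>The approximation property is given for \<open>0 < \<epsilon> < 1\<close> only,
    which holds eventually as \<open>\<epsilon>\<close> decreases to 0.\<close>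
  have ev: "\<forall>\<^sub>F \<epsilon> in at_right 0. 0 < \<epsilon> \<and> \<epsilon> < (1::real)"
    unfolding eventually_at_right_field by (intro exI[of _ 1]) auto
  show "((\<lambda>\<epsilon>. hausdorff_distance (D \<epsilon> \<inter> sphere 0 1) (cone_base L)) \<longlongrightarrow> 0) (at_right 0)"
  proof (rule tendsto_sandwich[of "\<lambda>_. 0" _ _ "\<lambda>\<epsilon>. 2 * \<epsilon>"])
    show "\<forall>\<^sub>F \<epsilon> in at_right 0. 0 \<le> hausdorff_distance (D \<epsilon> \<inter> sphere 0 1) (cone_base L)"
      using ev
    proof eventually_elim
      case (elim \<epsilon>)
      then have "L \<subseteq> D \<epsilon>" using D[of \<epsilon>] by (simp add: outer_approximation_def)
      then show ?case
        by (intro hausdorff_distance_superset_nonneg cone_base_nonempty[OF pL])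
          (auto simp: cone_base_def)
    qed
    show "\<forall>\<^sub>F \<epsilon> in at_right 0. hausdorff_distance (D \<epsilon> \<inter> sphere 0 1) (cone_base L) \<le> 2 * \<epsilon>"
      using ev by eventually_elim (use D in \<open>simp add: outer_approximation_def\<close>)
    show "((\<lambda>\<epsilon>. 2 * \<epsilon>) \<longlongrightarrow> (0::real)) (at_right 0)" by (auto intro!: tendsto_eq_intros)
  qed auto
  assume R: "R > 0"
  show "((\<lambda>\<epsilon>. hausdorff_distance (D \<epsilon> \<inter> cball 0 R) (L \<inter> cball 0 R)) \<longlongrightarrow> 0) (at_right 0)"
  proof (rule tendsto_sandwich[of "\<lambda>_. 0" _ _ "\<lambda>\<epsilon>. 2 * R * \<epsilon>"])
    show "\<forall>\<^sub>F \<epsilon> in at_right 0. 0 \<le> hausdorff_distance (D \<epsilon> \<inter> cball 0 R) (L \<inter> cball 0 R)"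
      using ev
    proof eventually_elim
      case (elim \<epsilon>)
      then have "L \<subseteq> D \<epsilon>" using D[of \<epsilon>] by (simp add: outer_approximation_def)
      moreover have "0 \<in> L \<inter> cball 0 R" using pL R by (auto simp: proper_cone_def)
      ultimately show ?case by (intro hausdorff_distance_superset_nonneg) auto
    qed
    show "\<forall>\<^sub>F \<epsilon> in at_right 0. hausdorff_distance (D \<epsilon> \<inter> cball 0 R) (L \<inter> cball 0 R) \<le> 2 * R * \<epsilon>"
      using ev by eventually_elim (use D R in \<open>simp add: outer_approximation_def\<close>)
    show "((\<lambda>\<epsilon>. 2 * R * \<epsilon>) \<longlongrightarrow> 0) (at_right 0)" by (auto intro!: tendsto_eq_intros)
  qed auto
qed

section \<open>The separating function \<open>Phi_BP\<close>\<close>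

lemma Phi_BP_nonneg_iff:
  assumes "m \<ge> 1"
  shows "0 \<le> Phi_BP m g \<alpha> x \<longleftrightarrow> x \<in> (\<Union>i\<in>{1..m}. bp_cone (g i) (\<alpha> i))"
  using assms by (auto simp: Phi_BP_def Max_ge_iff bp_cone_def)

lemma Phi_BP_pos_iff:
  assumes "m \<ge> 1"
  shows "0 < Phi_BP m g \<alpha> x \<longleftrightarrow> (\<exists>i\<in>{1..m}. blinfun_apply (g i) x > \<alpha> i * norm x)"
  using assms by (auto simp: Phi_BP_def Max_gr_iff)

lemma continuous_on_Max_image:
  fixes f :: "'i \<Rightarrow> 'a::topological_space \<Rightarrow> real"
  assumes "finite I" "I \<noteq> {}" "\<And>i. i \<in> I \<Longrightarrow> continuous_on S (f i)"
  shows "continuous_on S (\<lambda>x. Max ((\<lambda>i. f i x) ` I))"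
  using assms
proof (induction I rule: finite_ne_induct)
  case (insert i I)
  then show ?case by (auto intro!: continuous_on_max simp: image_insert)
qed simp

lemma continuous_on_Phi_BP:
  assumes "m \<ge> 1"
  shows "continuous_on UNIV (Phi_BP m g \<alpha>)"
  unfolding Phi_BP_def using assms
  by (intro continuous_intros continuous_on_Max_image) auto

lemma positively_homogeneous_Phi_BP:
  assumes "m \<ge> 1"
  shows "positively_homogeneous (Phi_BP m g \<alpha>)"
  unfolding positively_homogeneous_def
proof (intro allI impI)
  fix t :: real and x :: 'a assume t: "0 \<le> t"
  let ?A = "(\<lambda>i. blinfun_apply (g i) x - \<alpha> i * norm x) ` {1..m}"
  have "(\<lambda>i. blinfun_apply (g i) (t *\<^sub>R x) - \<alpha> i * norm (t *\<^sub>R x)) ` {1..m} = (*) t ` ?A"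
    using t by (auto simp: image_image blinfun.scaleR_right algebra_simps)
  \<comment> \<open>Multiplication by \<open>t \<ge> 0\<close> is monotone and therefore commutes
    with a finite maximum; this includes \<open>t = 0\<close>.\<close>
  moreover have "Max ((*) t ` ?A) = t * Max ?A"
    using assms t by (intro mono_Max_commute[symmetric]) (auto intro: monoI mult_left_mono)
  ultimately show "Phi_BP m g \<alpha> (t *\<^sub>R x) = t *\<^sub>R Phi_BP m g \<alpha> x"
    by (simp add: Phi_BP_def)
qed

text \<open>The maximum is attained at some \<open>i\<close>, where both \<open>g i x\<close> and
  \<open>\<alpha> i * norm x\<close> are at most \<open>norm x\<close> in absolute value. The factor
  1/2 in \<open>Phi_BP\<close> compensates for adding the two bounds.\<close>

lemma abs_Phi_BP_le:
  assumes "m \<ge> 1" and "\<And>i. i \<in> {1..m} \<Longrightarrow> norm (g i) = 1 \<and> 0 < \<alpha> i \<and> \<alpha> i < 1"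
  shows "\<bar>Phi_BP m g \<alpha> x\<bar> \<le> norm x"
proof -
  let ?A = "(\<lambda>i. blinfun_apply (g i) x - \<alpha> i * norm x) ` {1..m}"
  have "Max ?A \<in> ?A" using assms(1) by (intro Max_in) auto
  then obtain i where i: "i \<in> {1..m}" "Max ?A = blinfun_apply (g i) x - \<alpha> i * norm x" by blast
  have "\<bar>blinfun_apply (g i) x\<bar> \<le> norm x"
    using norm_blinfun[of "g i" x] assms(2)[OF i(1)] by simp
  moreover have "\<bar>\<alpha> i * norm x\<bar> \<le> norm x"
    using assms(2)[OF i(1)] by (simp add: abs_mult mult_left_le_one_le)
  ultimately show ?thesis using i(2) by (simp add: Phi_BP_def)
qed

text \<open>The interior of a Bishop--Phelps cone is \<open>{g > \<alpha> \<parallel>\<cdot>\<parallel>}\<close> for every pair \<open>(g, \<alpha>)\<close> representing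
  it, so the lower bound does not depend on the representation.\<close>

lemma Phi_BP_lower_bound:
  assumes L: "locally_compact_cone L" and m: "m \<ge> 1"
    and g: "\<And>i. i \<in> {1..m} \<Longrightarrow> norm (g i) = 1 \<and> 0 < \<alpha> i \<and> \<alpha> i < 1"
    and int: "L - {0} \<subseteq> (\<Union>i\<in>{1..m}. interior (bp_cone (g i) (\<alpha> i)))"
  shows "\<exists>\<eta>>0. \<forall>l \<in> L - {0}. Phi_BP m g \<alpha> l \<ge> \<eta> * norm l \<and> \<eta> * norm l > 0"
proof -
  have pL: "proper_cone L" using L by (simp add: locally_compact_cone_def)
  have pos: "Phi_BP m g \<alpha> l > 0" if l: "l \<in> L - {0}" for l
  proof -
    obtain i where i: "i \<in> {1..m}" "l \<in> interior (bp_cone (g i) (\<alpha> i))"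
      using l int by blast
    then have "blinfun_apply (g i) l > \<alpha> i * norm l"
      using g[OF i(1)] by (simp add: interior_bp_cone)
    then show ?thesis unfolding Phi_BP_pos_iff[OF m] using i(1) by blast
  qed
  \<comment> \<open>The minimum of the continuous function over the compact base serves as
    \<open>\<eta>\<close>; positive homogeneity carries the bound to all of
    \<open>L - {0}\<close>.\<close>
  obtain b where b: "b \<in> cone_base L" "\<And>y. y \<in> cone_base L \<Longrightarrow> Phi_BP m g \<alpha> b \<le> Phi_BP m g \<alpha> y"
    using continuous_attains_inf[OF compact_cone_base[OF L] cone_base_nonempty[OF pL]]
      continuous_on_subset[OF continuous_on_Phi_BP[OF m]] by blast
  have "Phi_BP m g \<alpha> b > 0" using b(1) by (intro pos) (auto simp: cone_base_def)
  moreover have "Phi_BP m g \<alpha> l \<ge> Phi_BP m g \<alpha> b * norm l" if "l \<in> L - {0}" for l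
  proof -
    have "Phi_BP m g \<alpha> l = norm l * Phi_BP m g \<alpha> ((1 / norm l) *\<^sub>R l)"
      using positively_homogeneous_Phi_BP[OF m, of g \<alpha>] that
      unfolding positively_homogeneous_def by simp
    moreover have "Phi_BP m g \<alpha> b \<le> Phi_BP m g \<alpha> ((1 / norm l) *\<^sub>R l)"
      using that by (intro b normalize_in_cone_base[OF pL]) auto
    ultimately show ?thesis by (simp add: mult.commute mult_left_mono)
  qed
  ultimately show ?thesis by (intro exI[of _ "Phi_BP m g \<alpha> b"]) auto
qed

section \<open>Separation of two cones and the three claims\<close>

text \<open>Disjoint nonempty sets, one compact and one closed, have positive distance. Assuming
  inclusion in \<open>{0}\<close> instead of equality lets \<open>K\<close> be either a closed cone
  or the base of a locally compact one, which does not contain 0.\<close>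

lemma setdist_cone_base_pos:
  assumes "locally_compact_cone L" "closed K" "K \<noteq> {}" "L \<inter> K \<subseteq> {0}"
  shows "setdist (cone_base L) K > 0"
proof -
  have "cone_base L \<inter> K = {}" using assms(4) by (auto simp: cone_base_def)
  then have "setdist (cone_base L) K \<noteq> 0"
    using setdist_eq_0_compact_closed[OF compact_cone_base[OF assms(1)] assms(2)]
      cone_base_nonempty assms(1,3) by (auto simp: locally_compact_cone_def)
  then show ?thesis using setdist_pos_le[of "cone_base L" K] by linarith
qed

text \<open>Convergence is claimed for every admissible family \<open>D\<close>, and the properties
  of \<open>Phi_BP\<close> for every pair \<open>g\<close>, \<open>\<alpha>\<close> representing the
  cones, so neither depends on choices made in the construction.\<close>

theorem corollary4p4:
  assumes denting: "\<forall>u \<in> sphere (0 :: 'a::real_normed_vector) 1. denting_point_of_ball u"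
  shows
    "(\<forall>L :: 'a set. locally_compact_cone L \<longrightarrow>
        (\<forall>\<epsilon>. 0 < \<epsilon> \<and> \<epsilon> < 1 \<longrightarrow>
          (\<exists>m C. bp_cones m C \<and> outer_approximation L \<epsilon> (\<Union>i\<in>{1..m}. C i))) \<and>
        (\<forall>D. (\<forall>\<epsilon>. 0 < \<epsilon> \<and> \<epsilon> < 1 \<longrightarrow> finite_bp_union (D \<epsilon>) \<and> outer_approximation L \<epsilon> (D \<epsilon>)) \<longrightarrow>
          ((\<lambda>\<epsilon>. hausdorff_distance (D \<epsilon> \<inter> sphere 0 1) (cone_base L)) \<longlongrightarrow> 0) (at_right 0) \<and>
          (\<forall>R>0. ((\<lambda>\<epsilon>. hausdorff_distance (D \<epsilon> \<inter> cball 0 R) (L \<inter> cball 0 R)) \<longlongrightarrow> 0) (at_right 0))))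
     \<and>
     (\<forall>L K :: 'a set. locally_compact_cone L \<and> proper_cone K \<and> closed K \<and> L \<inter> K = {0} \<longrightarrow>
        setdist (cone_base L) K > 0 \<and>
        (\<forall>\<epsilon>. 0 < \<epsilon> \<and> \<epsilon> < min 1 (setdist (cone_base L) K) \<longrightarrow>
          (\<exists>m C. bp_cones m C \<and> outer_approximation L \<epsilon> (\<Union>i\<in>{1..m}. C i) \<and>
            (\<Union>i\<in>{1..m}. C i) \<inter> K = {0} \<and>
            (\<forall>g \<alpha>. (\<forall>i\<in>{1..m}. norm (g i) = 1 \<and> 0 < \<alpha> i \<and> \<alpha> i < 1 \<and> C i = bp_cone (g i) (\<alpha> i)) \<longrightarrow>
              continuous_on UNIV (Phi_BP m g \<alpha>) \<and>
              positively_homogeneous (Phi_BP m g \<alpha>) \<and>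
              (\<Union>i\<in>{1..m}. C i) = {x. Phi_BP m g \<alpha> x \<ge> 0} \<and>
              (\<forall>x. \<bar>Phi_BP m g \<alpha> x\<bar> \<le> norm x) \<and>
              (\<exists>\<eta>>0. \<forall>l \<in> L - {0}. Phi_BP m g \<alpha> l \<ge> \<eta> * norm l \<and> \<eta> * norm l > 0) \<and>
              (\<forall>k \<in> K - {0}. Phi_BP m g \<alpha> k < 0)))))
     \<and>
     (\<forall>L K :: 'a set. locally_compact_cone L \<and> locally_compact_cone K \<and> L \<inter> K = {0} \<longrightarrow>
        setdist (cone_base L) (cone_base K) > 0 \<and>
        (\<forall>\<epsilon>. 0 < \<epsilon> \<and> \<epsilon> < min 1 (setdist (cone_base L) (cone_base K) / 4) \<longrightarrow>
          (\<exists>DL DK. finite_bp_union DL \<and> finite_bp_union DK \<and>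
            L - {0} \<subseteq> interior DL \<and> K - {0} \<subseteq> interior DK \<and>
            L \<subseteq> DL \<and> DL \<subseteq> cone_enlargement L \<epsilon> \<and>
            K \<subseteq> DK \<and> DK \<subseteq> cone_enlargement K \<epsilon> \<and>
            DL \<inter> DK = {0} \<and>
            max (hausdorff_distance (DL \<inter> sphere 0 1) (cone_base L))
                (hausdorff_distance (DK \<inter> sphere 0 1) (cone_base K)) \<le> 2 * \<epsilon> \<and>
            (\<forall>R>0. max (hausdorff_distance (DL \<inter> cball 0 R) (L \<inter> cball 0 R))
                        (hausdorff_distance (DK \<inter> cball 0 R) (K \<inter> cball 0 R)) \<le> 2 * R * \<epsilon>))))"
  (is "?i \<and> ?ii \<and> ?iii")
proof (intro conjI)
  show ?i
  proof (intro allI impI conjI)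
    fix L :: "'a set" and \<epsilon> :: real
    assume L: "locally_compact_cone L" and \<epsilon>: "0 < \<epsilon> \<and> \<epsilon> < 1"
    then have pL: "proper_cone L" by (simp add: locally_compact_cone_def)
    obtain m C where C: "bp_cones m C" "L - {0} \<subseteq> (\<Union>i\<in>{1..m}. interior (C i))"
      "\<And>x. x \<in> (\<Union>i\<in>{1..m}. C i) \<Longrightarrow> norm x = 1 \<Longrightarrow> \<exists>u \<in> cone_base L. dist x u < \<epsilon>"
      using finite_bp_cover[OF denting L, of \<epsilon>] \<epsilon> by metis
    have "outer_approximation L \<epsilon> (\<Union>i\<in>{1..m}. C i)"
      using \<epsilon> by (intro outer_approximationI[OF pL _ C]) auto
    with C(1) show "\<exists>m C. bp_cones m C \<and> outer_approximation L \<epsilon> (\<Union>i\<in>{1..m}. C i)"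
      by blast
  next
    fix L :: "'a set" and D
    assume "locally_compact_cone L"
      and "\<forall>\<epsilon>. 0 < \<epsilon> \<and> \<epsilon> < 1 \<longrightarrow> finite_bp_union (D \<epsilon>) \<and> outer_approximation L \<epsilon> (D \<epsilon>)"
    then have *: "proper_cone L" "\<And>\<epsilon>. 0 < \<epsilon> \<Longrightarrow> \<epsilon> < 1 \<Longrightarrow> outer_approximation L \<epsilon> (D \<epsilon>)"
      by (auto simp: locally_compact_cone_def)
    show "((\<lambda>\<epsilon>. hausdorff_distance (D \<epsilon> \<inter> sphere 0 1) (cone_base L)) \<longlongrightarrow> 0) (at_right 0)"
      using * by (rule outer_approximation_tendsto(1))
    show "((\<lambda>\<epsilon>. hausdorff_distance (D \<epsilon> \<inter> cball 0 R) (L \<inter> cball 0 R)) \<longlongrightarrow> 0) (at_right 0)"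
      if "R > 0" for R
      using * that by (rule outer_approximation_tendsto(2))
  qed
  show ?ii
  proof (intro allI impI, elim conjE, intro conjI allI impI)
    fix L K :: "'a set"
    assume L: "locally_compact_cone L" and K: "proper_cone K" "closed K" and LK: "L \<inter> K = {0}"
    have pL: "proper_cone L" using L by (simp add: locally_compact_cone_def)
    show "setdist (cone_base L) K > 0"
      using L K LK by (intro setdist_cone_base_pos) auto
    fix \<epsilon> assume \<epsilon>: "0 < \<epsilon> \<and> \<epsilon> < min 1 (setdist (cone_base L) K)"
    obtain m C where C: "bp_cones m C" and int: "L - {0} \<subseteq> (\<Union>i\<in>{1..m}. interior (C i))"
      and near: "\<And>x. x \<in> (\<Union>i\<in>{1..m}. C i) \<Longrightarrow> norm x = 1 \<Longrightarrow> \<exists>u \<in> cone_base L. dist x u < \<epsilon>"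
      using finite_bp_cover[OF denting L, of \<epsilon>] \<epsilon> by (metis min_less_iff_conj)
    let ?D = "\<Union>i\<in>{1..m}. C i"
    have m: "m \<ge> 1" using C by (simp add: bp_cones_def)
    have oa: "outer_approximation L \<epsilon> ?D"
      using \<epsilon> by (intro outer_approximationI[OF pL _ C int near]) auto
    \<comment> \<open>Normalizing a nonzero common point gives a unit vector of \<open>K\<close>
      closer than \<open>\<epsilon>\<close> to the base of \<open>L\<close>, against
      \<open>\<epsilon> < setdist (cone_base L) K\<close>.\<close>
    have "x = 0" if x: "x \<in> ?D" "x \<in> K" for x
    proof (rule ccontr)
      assume "x \<noteq> 0"
      let ?y = "(1 / norm x) *\<^sub>R x"
      have "?y \<in> ?D" using bp_union_scaleR[OF C x(1), of "1 / norm x"] by simp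
      then obtain u where u: "u \<in> cone_base L" "dist ?y u < \<epsilon>"
        using near[of ?y] \<open>x \<noteq> 0\<close> by auto
      have "?y \<in> K" using scaleR_in_cone[OF K(1) x(2)] by simp
      then have "setdist (cone_base L) K \<le> dist u ?y"
        using u(1) by (intro setdist_le_dist)
      then show False using u(2) \<epsilon> by (simp add: dist_commute)
    qed
    moreover have "0 \<in> K" using LK by auto
    ultimately have DK: "?D \<inter> K = {0}" using zero_in_bp_union[OF C] by blast
    show "\<exists>m C. bp_cones m C \<and> outer_approximation L \<epsilon> (\<Union>i\<in>{1..m}. C i) \<and>
            (\<Union>i\<in>{1..m}. C i) \<inter> K = {0} \<and>
            (\<forall>g \<alpha>. (\<forall>i\<in>{1..m}. norm (g i) = 1 \<and> 0 < \<alpha> i \<and> \<alpha> i < 1 \<and> C i = bp_cone (g i) (\<alpha> i)) \<longrightarrow>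
              continuous_on UNIV (Phi_BP m g \<alpha>) \<and>
              positively_homogeneous (Phi_BP m g \<alpha>) \<and>
              (\<Union>i\<in>{1..m}. C i) = {x. Phi_BP m g \<alpha> x \<ge> 0} \<and>
              (\<forall>x. \<bar>Phi_BP m g \<alpha> x\<bar> \<le> norm x) \<and>
              (\<exists>\<eta>>0. \<forall>l \<in> L - {0}. Phi_BP m g \<alpha> l \<ge> \<eta> * norm l \<and> \<eta> * norm l > 0) \<and>
              (\<forall>k \<in> K - {0}. Phi_BP m g \<alpha> k < 0))"
    proof (rule exI[of _ m], rule exI[of _ C], intro conjI C oa DK allI impI)
      fix g :: "nat \<Rightarrow> 'a \<Rightarrow>\<^sub>L real" and \<alpha> :: "nat \<Rightarrow> real"
      assume "\<forall>i\<in>{1..m}. norm (g i) = 1 \<and> 0 < \<alpha> i \<and> \<alpha> i < 1 \<and> C i = bp_cone (g i) (\<alpha> i)"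
      then have g: "\<And>i. i \<in> {1..m} \<Longrightarrow> norm (g i) = 1 \<and> 0 < \<alpha> i \<and> \<alpha> i < 1"
        and Ci: "\<And>i. i \<in> {1..m} \<Longrightarrow> C i = bp_cone (g i) (\<alpha> i)" by auto
      show "continuous_on UNIV (Phi_BP m g \<alpha>)" by (rule continuous_on_Phi_BP[OF m])
      show "positively_homogeneous (Phi_BP m g \<alpha>)" by (rule positively_homogeneous_Phi_BP[OF m])
      show D: "?D = {x. Phi_BP m g \<alpha> x \<ge> 0}"
        using Ci by (auto simp: Phi_BP_nonneg_iff[OF m])
      show "\<bar>Phi_BP m g \<alpha> x\<bar> \<le> norm x" for x by (rule abs_Phi_BP_le[OF m g])
      have "L - {0} \<subseteq> (\<Union>i\<in>{1..m}. interior (bp_cone (g i) (\<alpha> i)))"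
        using int Ci by auto
      then show "\<exists>\<eta>>0. \<forall>l \<in> L - {0}. Phi_BP m g \<alpha> l \<ge> \<eta> * norm l \<and> \<eta> * norm l > 0"
        using g by (intro Phi_BP_lower_bound[OF L m]) auto
      \<comment> \<open>A nonzero \<open>k\<close> in \<open>K\<close> is outside the union, which
        is exactly the set where \<open>Phi_BP\<close> is nonnegative.\<close>
      show "\<forall>k \<in> K - {0}. Phi_BP m g \<alpha> k < 0"
        using DK unfolding D by (force simp: not_le)
    qed
  qed
  show ?iii
  proof (intro allI impI, elim conjE, intro conjI allI impI)
    fix L K :: "'a set"
    assume L: "locally_compact_cone L" and K: "locally_compact_cone K" and LK: "L \<inter> K = {0}"
    have pL: "proper_cone L" and pK: "proper_cone K"
      using L K by (auto simp: locally_compact_cone_def)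
    show "setdist (cone_base L) (cone_base K) > 0"
      using compact_imp_closed[OF compact_cone_base[OF K]] cone_base_nonempty[OF pK] LK
      by (intro setdist_cone_base_pos[OF L]) (auto simp: cone_base_def)
    fix \<epsilon> assume \<epsilon>: "0 < \<epsilon> \<and> \<epsilon> < min 1 (setdist (cone_base L) (cone_base K) / 4)"
    obtain m C where C: "bp_cones m C" and intC: "L - {0} \<subseteq> (\<Union>i\<in>{1..m}. interior (C i))"
      and nearC: "\<And>x. x \<in> (\<Union>i\<in>{1..m}. C i) \<Longrightarrow> norm x = 1 \<Longrightarrow> \<exists>u \<in> cone_base L. dist x u < \<epsilon>"
      using finite_bp_cover[OF denting L, of \<epsilon>] \<epsilon> by (metis min_less_iff_conj)
    obtain n E where E: "bp_cones n E" and intE: "K - {0} \<subseteq> (\<Union>i\<in>{1..n}. interior (E i))"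
      and nearE: "\<And>x. x \<in> (\<Union>i\<in>{1..n}. E i) \<Longrightarrow> norm x = 1 \<Longrightarrow> \<exists>u \<in> cone_base K. dist x u < \<epsilon>"
      using finite_bp_cover[OF denting K, of \<epsilon>] \<epsilon> by (metis min_less_iff_conj)
    let ?DL = "\<Union>i\<in>{1..m}. C i" and ?DK = "\<Union>i\<in>{1..n}. E i"
    have oL: "outer_approximation L \<epsilon> ?DL"
      using \<epsilon> by (intro outer_approximationI[OF pL _ C intC nearC]) auto
    have oK: "outer_approximation K \<epsilon> ?DK"
      using \<epsilon> by (intro outer_approximationI[OF pK _ E intE nearE]) auto
    \<comment> \<open>A common unit vector would be within \<open>\<epsilon>\<close> of both bases,
      forcing their distance below \<open>2 * \<epsilon>\<close>, while \<open>\<epsilon>\<close> is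
      less than a quarter of it.\<close>
    have "x = 0" if x: "x \<in> ?DL" "x \<in> ?DK" for x
    proof (rule ccontr)
      assume "x \<noteq> 0"
      let ?y = "(1 / norm x) *\<^sub>R x"
      have "?y \<in> ?DL" using bp_union_scaleR[OF C x(1), of "1 / norm x"] by simp
      then obtain u where u: "u \<in> cone_base L" "dist ?y u < \<epsilon>"
        using nearC[of ?y] \<open>x \<noteq> 0\<close> by auto
      have "?y \<in> ?DK" using bp_union_scaleR[OF E x(2), of "1 / norm x"] by simp
      then obtain v where v: "v \<in> cone_base K" "dist ?y v < \<epsilon>"
        using nearE[of ?y] \<open>x \<noteq> 0\<close> by auto
      have "setdist (cone_base L) (cone_base K) \<le> dist u v"
        using u(1) v(1) by (intro setdist_le_dist)
      also have "\<dots> \<le> dist ?y u + dist ?y v"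
        using dist_triangle3[of u v ?y] by simp
      finally show False using u(2) v(2) \<epsilon> by simp
    qed
    then have "?DL \<inter> ?DK = {0}"
      using zero_in_bp_union[OF C] zero_in_bp_union[OF E] by blast
    moreover have "finite_bp_union ?DL" "finite_bp_union ?DK"
      using C E unfolding finite_bp_union_def by blast+
    ultimately show "\<exists>DL DK. finite_bp_union DL \<and> finite_bp_union DK \<and>
            L - {0} \<subseteq> interior DL \<and> K - {0} \<subseteq> interior DK \<and>
            L \<subseteq> DL \<and> DL \<subseteq> cone_enlargement L \<epsilon> \<and>
            K \<subseteq> DK \<and> DK \<subseteq> cone_enlargement K \<epsilon> \<and>
            DL \<inter> DK = {0} \<and>
            max (hausdorff_distance (DL \<inter> sphere 0 1) (cone_base L))
                (hausdorff_distance (DK \<inter> sphere 0 1) (cone_base K)) \<le> 2 * \<epsilon> \<and>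
            (\<forall>R>0. max (hausdorff_distance (DL \<inter> cball 0 R) (L \<inter> cball 0 R))
                        (hausdorff_distance (DK \<inter> cball 0 R) (K \<inter> cball 0 R)) \<le> 2 * R * \<epsilon>)"
      using oL oK unfolding outer_approximation_def
      by - (rule exI[of _ ?DL], rule exI[of _ ?DK], simp only: max.bounded_iff simp_thms, simp)
  qed
qed

end
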